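(* Let $n,B_1,B_2$ be positive integers with $n\ge B_1+B_2\ge 2B_1$, let $k\ge3$ be odd with $B_2/k$ a positive integer, and let $f_j=1/j$ for $j\in[n]$. Let $h_1,\dots,h_k:[n]\setminus[B_1]\to[B_2/k]$ and $s_1,\dots,s_k:[n]\setminus[B_1]\to\{-1,1\}$ be independent, truly (uniformly) random functions. For $i\in[n]\setminus[B_1]$ define $$\tilde f_i=\mathrm{median}_{\ell\in[k]}\left(s_\ell(i)\sum_{j\in[n]\setminus[B_1]}[h_\ell(j)=h_\ell(i)]\,s_\ell(j)f_j\right).$$ Then for every $i\in[n]\setminus[B_1]$, $\mathbb{E}[|\tilde f_i-f_i|]=\Omega(1/B_2)$, with an absolute implied constant.
   Context: $[E]$ denotes the indicator of the event $E$; $[m]=\{1,\dots,m\}$. For odd $k$, the median of $k$ reals is the middle value after sorting. *)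

theory Defs
  imports "HOL-Probability.Probability"
begin

text \<open>The middle value of an odd-length list after sorting (list positions start at 0).\<close>

definition median :: "real list \<Rightarrow> real" where
  "median xs = sort xs ! (length xs div 2)"

definition freq :: "nat \<Rightarrow> real" where
  "freq j = 1 / real j"

definition unif_fun :: "nat set \<Rightarrow> 'a set \<Rightarrow> (nat \<Rightarrow> 'a) pmf" where
  "unif_fun A R = pmf_of_set (A \<rightarrow>\<^sub>E R)"

text \<open>
  Joint law of the pair \<open>(h, s)\<close>, where \<open>h l\<close> and \<open>s l\<close> for \<open>l \<in> {1..k}\<close> are
  mutually independent uniformly random functions on \<open>{1..n} - {1..B1}\<close>;
  values for \<open>l\<close> outside \<open>{1..k}\<close> are irrelevant.
\<close>

definition sketch_pmf ::
  "nat \<Rightarrow> nat \<Rightarrow> nat \<Rightarrow> nat \<Rightarrow> ((nat \<Rightarrow> nat \<Rightarrow> nat) \<times> (nat \<Rightarrow> nat \<Rightarrow> real)) pmf" where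
  "sketch_pmf n B1 B2 k =
     pair_pmf
       (Pi_pmf {1..k} undefined (\<lambda>_. unif_fun ({1..n} - {1..B1}) {1..B2 div k}))
       (Pi_pmf {1..k} undefined (\<lambda>_. unif_fun ({1..n} - {1..B1}) {-1, 1}))"

definition estimate ::
  "nat \<Rightarrow> nat \<Rightarrow> nat \<Rightarrow> (nat \<Rightarrow> nat \<Rightarrow> nat) \<Rightarrow> (nat \<Rightarrow> nat \<Rightarrow> real) \<Rightarrow> nat \<Rightarrow> real" where
  "estimate n B1 k h s i =
     median (map (\<lambda>l. s l i * (\<Sum>j\<in>{1..n} - {1..B1}. of_bool (h l j = h l i) * s l j * freq j))
                 [1..<k + 1])"

end

theory Submission
  imports Defs
begin

text \<open>
  Only collisions with the \<open>B2\<close> largest remaining frequencies \<open>1 / j \<ge> 1 / (2 * B2)\<close> matter. Fix \<open>h\<close>, let \<open>M l\<close>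
  be the number of these that collide with \<open>i\<close> in row \<open>l\<close>, and call \<open>s l i * s l j\<close> the relative
  sign of \<open>j\<close>. Turning one relative sign from \<open>-1\<close> to \<open>1\<close> in every row raises every row estimate,
  hence the median, by at least \<open>1 / B2\<close>, so the error is at least \<open>1 / (2 * B2)\<close> before or after.
  Choosing the flipped indices uniformly at random, both the state before and the state after the
  flip have a density with respect to the uniform law, with second moment \<open>\<Prod>l. 1 + 1 / M l\<close>.
  Hence the error is at least \<open>1 / (2 * B2)\<close> with probability at least
  \<open>1 / 4 * (\<Prod>l. M l / (M l + 1))\<close>. The rows of \<open>h\<close> are independent and
  the mean of \<open>1 / (M l + 1)\<close> is at most \<open>1 / k\<close>, so averaging over \<open>h\<close> leaves at least
  \<open>1 / 4 * (1 - 1 / k) ^ k \<ge> 1 / 36\<close>.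
\<close>

section \<open>Order statistics and the median under a pointwise shift\<close>

text \<open>At least \<open>m + 1\<close> entries of \<open>ys\<close> are at most
  \<open>sort ys ! m\<close>. The entries of \<open>xs\<close> at the same positions are smaller by
  at least \<open>d\<close>, and this count bounds entry \<open>m\<close> of
  \<open>sort xs\<close>.\<close>

lemma sort_nth_add_mono:
  fixes xs ys :: "real list"
  assumes len: "length xs = length ys" and m: "m < length ys"
    and le: "\<And>p. p < length ys \<Longrightarrow> xs ! p + d \<le> ys ! p"
  shows "sort xs ! m + d \<le> sort ys ! m"
proof (rule ccontr)
  define v where "v = sort ys ! m"
  assume "\<not> ?thesis"
  then have gt: "v - d < sort xs ! m" by (simp add: v_def)
  have count: "length (filter P zs) = card {p. p < length zs \<and> P (sort zs ! p)}"
    for P and zs :: "real list"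
    using length_filter_conv_card[of P "sort zs"] by (simp add: filter_sort)
  have "m + 1 = card {..m}" by simp
  also have "\<dots> \<le> card {p. p < length ys \<and> sort ys ! p \<le> v}"
    using m by (intro card_mono) (auto simp: v_def intro!: sorted_nth_mono)
  also have "\<dots> = card {p. p < length ys \<and> ys ! p \<le> v}"
    using count[of "\<lambda>x. x \<le> v" ys] by (simp add: length_filter_conv_card)
  also have "\<dots> \<le> card {p. p < length xs \<and> xs ! p \<le> v - d}"
    using le len by (intro card_mono) (auto, smt (verit))
  also have "\<dots> = card {p. p < length xs \<and> sort xs ! p \<le> v - d}"
    using count[of "\<lambda>x. x \<le> v - d" xs] by (simp add: length_filter_conv_card)
  also have "\<dots> \<le> card {..<m}"
  proof (intro card_mono subsetI)
    fix p assume p: "p \<in> {p. p < length xs \<and> sort xs ! p \<le> v - d}"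
    show "p \<in> {..<m}"
    proof (rule ccontr)
      assume "p \<notin> {..<m}"
      then have "sort xs ! m \<le> sort xs ! p"
        using p by (intro sorted_nth_mono) auto
      then show False using p gt by simp
    qed
  qed simp
  finally show False by simp
qed

lemma median_map_add_mono:
  assumes "xs \<noteq> []" "\<And>l. l \<in> set xs \<Longrightarrow> f l + d \<le> g l"
  shows "median (map f xs) + d \<le> median (map g xs)"
  unfolding median_def using assms by (auto intro!: sort_nth_add_mono)

section \<open>Moments of uniformly random signs\<close>

abbreviation sign_funs :: "nat set \<Rightarrow> (nat \<Rightarrow> real) set" where
  "sign_funs D \<equiv> D \<rightarrow>\<^sub>E {-1, 1}"

lemma sign_funs_square: "s \<in> sign_funs D \<Longrightarrow> a \<in> D \<Longrightarrow> s a * s a = 1"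
  by (drule PiE_mem) auto

lemma bij_betw_flip_sign:
  assumes "a \<in> D"
  shows "bij_betw (\<lambda>s. s(a := - s a)) (sign_funs D) (sign_funs D)"
proof (rule bij_betw_byWitness[where f' = "\<lambda>s. s(a := - s a)"])
  have "s(a := - s a) \<in> sign_funs D" if "s \<in> sign_funs D" for s
    using assms that PiE_mem[OF that assms] by (auto simp: PiE_iff extensional_def)
  then show "(\<lambda>s. s(a := - s a)) ` sign_funs D \<subseteq> sign_funs D"
    and "(\<lambda>s. s(a := - s a)) ` sign_funs D \<subseteq> sign_funs D" by auto
qed auto

text \<open>Signs at distinct points are uncorrelated: negating the sign at \<open>a\<close>
  permutes the sign functions and negates the product.\<close>

lemma sum_sign_funs_mult:
  assumes "a \<in> D" "b \<in> D"
  shows "(\<Sum>s\<in>sign_funs D. s a * s b) = (if a = b then real (card (sign_funs D)) else 0)"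
proof (cases "a = b")
  case True
  then show ?thesis using assms by (simp add: sign_funs_square)
next
  case False
  have "(\<Sum>s\<in>sign_funs D. s a * s b) = (\<Sum>s\<in>sign_funs D. (s(a := - s a)) a * (s(a := - s a)) b)"
    by (rule sum.reindex_bij_betw[OF bij_betw_flip_sign[OF assms(1)], symmetric])
  also have "\<dots> = - (\<Sum>s\<in>sign_funs D. s a * s b)"
    using False by (simp add: sum_negf)
  finally show ?thesis using False by simp
qed

text \<open>The relative signs \<open>s i * s j\<close> have mean zero and are pairwise
  uncorrelated, so their average over \<open>C\<close> has variance \<open>1 / card C\<close>. The
  factor \<open>e\<close> stands for 1 or -1, the densities after and before a flip.\<close>

lemma sum_sign_funs_mean_square:
  assumes D: "finite D" and C: "C \<subseteq> D" "C \<noteq> {}" and i: "i \<in> D" "i \<notin> C" and e: "e * e = 1"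
  shows "(\<Sum>s\<in>sign_funs D. (1 + e * (\<Sum>j\<in>C. s i * s j) / card C)\<^sup>2) =
         card (sign_funs D) * (1 + 1 / card C)"
proof -
  have fC: "finite C" using C D finite_subset by blast
  then have c0: "card C \<noteq> 0" using C by simp
  \<comment> \<open>In the quadratic term the common factor \<open>s i\<close> squares to 1, which
    leaves only pairs of signs within \<open>C\<close>.\<close>
  have *: "(1 + e * (\<Sum>j\<in>C. s i * s j) / card C)\<^sup>2 =
     1 + 2 * e / card C * (\<Sum>j\<in>C. s i * s j) + (\<Sum>j\<in>C. \<Sum>j'\<in>C. s j * s j') / (card C)\<^sup>2"
    if "s \<in> sign_funs D" for s
  proof -
    have "(e * (\<Sum>j\<in>C. s i * s j))\<^sup>2 = (e * e) * (s i * s i) * ((\<Sum>j\<in>C. s j) * (\<Sum>j\<in>C. s j))"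
      unfolding sum_distrib_left[symmetric] by (simp add: power2_eq_square)
    also have "\<dots> = (\<Sum>j\<in>C. \<Sum>j'\<in>C. s j * s j')"
      using e sign_funs_square[OF that i(1)] by (simp add: sum_product)
    finally show ?thesis
      by (simp add: power2_sum power_divide)
  qed
  have 1: "(\<Sum>s\<in>sign_funs D. \<Sum>j\<in>C. s i * s j) = 0"
  proof (subst sum.swap, rule sum.neutral, rule ballI)
    fix j assume "j \<in> C"
    then have "j \<in> D" "i \<noteq> j" using C i by auto
    then show "(\<Sum>s\<in>sign_funs D. s i * s j) = 0" using i by (simp add: sum_sign_funs_mult)
  qed
  have 2: "(\<Sum>s\<in>sign_funs D. \<Sum>j\<in>C. \<Sum>j'\<in>C. s j * s j') = card C * card (sign_funs D)"
  proof -
    have "(\<Sum>s\<in>sign_funs D. \<Sum>j\<in>C. \<Sum>j'\<in>C. s j * s j') =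
          (\<Sum>j\<in>C. \<Sum>j'\<in>C. \<Sum>s\<in>sign_funs D. s j * s j')"
      by (subst sum.swap, rule sum.cong[OF refl], rule sum.swap)
    also have "\<dots> = (\<Sum>j\<in>C. \<Sum>j'\<in>C. if j = j' then real (card (sign_funs D)) else 0)"
      using C(1) by (intro sum.cong refl sum_sign_funs_mult) auto
    also have "\<dots> = card C * card (sign_funs D)" using fC by simp
    finally show ?thesis .
  qed
  define P where "P s = (\<Sum>j\<in>C. s i * s j)" for s :: "nat \<Rightarrow> real"
  define Q where "Q s = (\<Sum>j\<in>C. \<Sum>j'\<in>C. s j * s j')" for s :: "nat \<Rightarrow> real"
  have "(\<Sum>s\<in>sign_funs D. (1 + e * P s / card C)\<^sup>2) =
        (\<Sum>s\<in>sign_funs D. 1 + 2 * e / card C * P s + Q s / (card C)\<^sup>2)"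
    unfolding P_def Q_def by (rule sum.cong[OF refl *])
  also have "\<dots> = card (sign_funs D) + 2 * e / card C * (\<Sum>s\<in>sign_funs D. P s) +
                    (\<Sum>s\<in>sign_funs D. Q s) / (card C)\<^sup>2"
    by (simp add: sum.distrib sum_distrib_left sum_divide_distrib)
  also have "\<dots> = card (sign_funs D) * (1 + 1 / card C)"
    using c0 1 2 by (simp add: P_def Q_def field_simps power2_eq_square)
  finally show ?thesis unfolding P_def .
qed

section \<open>Expected inverse bucket size\<close>

text \<open>Summing \<open>1 / (size of the bucket of j)\<close> over the \<open>j \<in> V\<close> counts the nonempty buckets; by
  exchangeability every \<open>j\<close> contributes the same amount on average.\<close>

lemma sum_inverse_bucket_size:
  fixes D V :: "nat set"
  assumes D: "finite D" and V: "V \<subseteq> D" and i: "i \<in> V" and R: "finite R"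
  shows "card V * (\<Sum>g\<in>D \<rightarrow>\<^sub>E R. 1 / real (card {j\<in>V. g j = g i})) \<le>
         card R * real (card (D \<rightarrow>\<^sub>E R))"
proof -
  have fV: "finite V" using D V finite_subset by blast
  have swap: "(\<Sum>g\<in>D \<rightarrow>\<^sub>E R. 1 / real (card {j\<in>V. g j = g a})) =
              (\<Sum>g\<in>D \<rightarrow>\<^sub>E R. 1 / real (card {j\<in>V. g j = g i}))" if a: "a \<in> V" for a
  proof -
    \<comment> \<open>Precomposing with this transposition permutes the functions on
      \<open>D\<close> and carries the bucket of \<open>a\<close> to that of
      \<open>i\<close>.\<close>
    let ?t = "Transposition.transpose a i"
    have tD: "?t x \<in> D \<longleftrightarrow> x \<in> D" and tV: "?t x \<in> V \<longleftrightarrow> x \<in> V" for x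
      using a i V by (auto simp: Transposition.transpose_def)
    have bij: "bij_betw (\<lambda>g. g \<circ> ?t) (D \<rightarrow>\<^sub>E R) (D \<rightarrow>\<^sub>E R)"
      by (rule bij_betw_byWitness[where f' = "\<lambda>g. g \<circ> ?t"])
         (auto simp: o_def PiE_iff extensional_def tD)
    have "card {j\<in>V. (g \<circ> ?t) j = (g \<circ> ?t) a} = card {j\<in>V. g j = g i}" for g :: "nat \<Rightarrow> 'a"
      by (rule bij_betw_same_card[of ?t], rule bij_betw_byWitness[where f' = ?t])
         (auto simp: tV)
    then show ?thesis
      by (subst sum.reindex_bij_betw[OF bij, symmetric]) simp
  qed
  have buckets: "(\<Sum>a\<in>V. 1 / real (card {j\<in>V. g j = g a})) \<le> card R" if g: "g \<in> D \<rightarrow>\<^sub>E R" for g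
  proof -
    have "(\<Sum>a\<in>V. 1 / real (card {j\<in>V. g j = g a})) =
          (\<Sum>r\<in>g ` V. \<Sum>a\<in>{a\<in>V. g a = r}. 1 / real (card {j\<in>V. g j = g a}))"
      by (rule sum.image_gen[OF fV])
    also have "\<dots> = (\<Sum>r\<in>g ` V. 1)"
    proof (rule sum.cong[OF refl])
      fix r assume "r \<in> g ` V"
      then have "{a\<in>V. g a = r} \<noteq> {}" by auto
      then show "(\<Sum>a\<in>{a\<in>V. g a = r}. 1 / real (card {j\<in>V. g j = g a})) = 1"
        using fV by simp
    qed
    also have "\<dots> \<le> card R"
      using R g V by (auto intro!: card_mono)
    finally show ?thesis .
  qed
  have "card V * (\<Sum>g\<in>D \<rightarrow>\<^sub>E R. 1 / real (card {j\<in>V. g j = g i})) =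
        (\<Sum>a\<in>V. \<Sum>g\<in>D \<rightarrow>\<^sub>E R. 1 / real (card {j\<in>V. g j = g a}))"
    by (simp add: swap)
  also have "\<dots> = (\<Sum>g\<in>D \<rightarrow>\<^sub>E R. \<Sum>a\<in>V. 1 / real (card {j\<in>V. g j = g a}))"
    by (rule sum.swap)
  also have "\<dots> \<le> (\<Sum>g\<in>D \<rightarrow>\<^sub>E R. card R)"
    unfolding of_nat_sum by (intro sum_mono buckets)
  finally show ?thesis by (simp add: mult.commute)
qed

section \<open>Uniform product laws as finite averages\<close>

lemma pair_pmf_of_set:
  assumes "finite A" "A \<noteq> {}" "finite B" "B \<noteq> {}"
  shows "pair_pmf (pmf_of_set A) (pmf_of_set B) = pmf_of_set (A \<times> B)"
proof (rule pmf_eqI)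
  fix x :: "'a \<times> 'b"
  show "pmf (pair_pmf (pmf_of_set A) (pmf_of_set B)) x = pmf (pmf_of_set (A \<times> B)) x"
    using assms by (cases x) (simp add: pmf_pair indicator_def card_cartesian_product)
qed

lemma Pi_pmf_unif_fun:
  assumes "finite K" "finite D" "finite R" "R \<noteq> {}"
  shows "Pi_pmf K undefined (\<lambda>_. unif_fun D R) = pmf_of_set (K \<rightarrow>\<^sub>E (D \<rightarrow>\<^sub>E R))"
proof -
  have "PiE_dflt K undefined (\<lambda>_. D \<rightarrow>\<^sub>E R) = (K \<rightarrow>\<^sub>E (D \<rightarrow>\<^sub>E R))"
    by (auto simp: PiE_dflt_def PiE_iff extensional_def)
  then show ?thesis
    unfolding unif_fun_def using assms
    by (subst Pi_pmf_of_set) (auto simp: finite_PiE PiE_eq_empty_iff)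
qed

text \<open>Turns the probabilistic statement into counting, with \<open>h\<close> outermost so that
  it can be fixed while the signs vary.\<close>

lemma expectation_sketch_pmf:
  fixes n B1 B2 k :: nat
  assumes "0 < B2 div k"
  defines "H \<equiv> {1..k} \<rightarrow>\<^sub>E (({1..n} - {1..B1}) \<rightarrow>\<^sub>E {1..B2 div k})"
    and "S \<equiv> {1..k} \<rightarrow>\<^sub>E sign_funs ({1..n} - {1..B1})"
  shows "measure_pmf.expectation (sketch_pmf n B1 B2 k) f =
         (\<Sum>h\<in>H. \<Sum>s\<in>S. f (h, s)) / (real (card H) * real (card S))"
proof -
  have H: "finite H" "H \<noteq> {}" and S: "finite S" "S \<noteq> {}"
    using assms(1) by (auto simp: H_def S_def finite_PiE PiE_eq_empty_iff)
  have "sketch_pmf n B1 B2 k = pmf_of_set (H \<times> S)"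
  proof -
    have "sketch_pmf n B1 B2 k = pair_pmf (pmf_of_set H) (pmf_of_set S)"
      using assms(1) unfolding sketch_pmf_def H_def S_def
      by (intro arg_cong2[of _ _ _ _ pair_pmf] Pi_pmf_unif_fun) auto
    then show ?thesis using H S by (simp add: pair_pmf_of_set)
  qed
  then show ?thesis
    using H S by (simp add: integral_pmf_of_set sum.cartesian_product card_cartesian_product)
qed

lemma sum_PiE_prod:
  fixes f :: "'a \<Rightarrow> 'c \<Rightarrow> real"
  assumes "finite K" "finite A"
  shows "(\<Sum>g\<in>K \<rightarrow>\<^sub>E A. \<Prod>l\<in>K. f l (g l)) = (\<Prod>l\<in>K. \<Sum>x\<in>A. f l x)"
  using assms by (simp add: prod_sum_PiE)

section \<open>Anticoncentration by flipping one sign per row\<close>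

text \<open>Values outside \<open>K\<close> stay untouched, so that extensional functions remain
  extensional and the map is an involution.\<close>

definition flip_signs :: "nat set \<Rightarrow> (nat \<Rightarrow> nat) \<Rightarrow> (nat \<Rightarrow> nat \<Rightarrow> real) \<Rightarrow> nat \<Rightarrow> nat \<Rightarrow> real" where
  "flip_signs K J s = (\<lambda>l. if l \<in> K then (s l)(J l := - s l (J l)) else s l)"

lemma bij_betw_flip_signs:
  assumes "\<And>l. l \<in> K \<Longrightarrow> J l \<in> D"
  shows "bij_betw (flip_signs K J) (K \<rightarrow>\<^sub>E sign_funs D) (K \<rightarrow>\<^sub>E sign_funs D)"
proof (rule bij_betw_byWitness[where f' = "flip_signs K J"])
  have "flip_signs K J s \<in> K \<rightarrow>\<^sub>E sign_funs D" if s: "s \<in> K \<rightarrow>\<^sub>E sign_funs D" for s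
  proof (rule PiE_I)
    fix l assume "l \<in> K"
    then show "flip_signs K J s l \<in> sign_funs D"
      using bij_betwE[OF bij_betw_flip_sign[OF assms]] PiE_mem[OF s]
      by (simp add: flip_signs_def)
  qed (use s in \<open>auto simp: flip_signs_def PiE_iff extensional_def\<close>)
  then show "flip_signs K J ` (K \<rightarrow>\<^sub>E sign_funs D) \<subseteq> K \<rightarrow>\<^sub>E sign_funs D"
    and "flip_signs K J ` (K \<rightarrow>\<^sub>E sign_funs D) \<subseteq> K \<rightarrow>\<^sub>E sign_funs D" by auto
qed (auto simp: flip_signs_def fun_eq_iff)

text \<open>The density \<open>\<Prod>l\<in>K. 1 - s l i * s l (J l)\<close> is supported on the states to which the flip
  hypothesis applies; averaging it over \<open>J\<close> brings its second moment down to
  \<open>\<Prod>l\<in>K. 1 + 1 / card (C l)\<close>.\<close>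

lemma flip_anticoncentration:
  fixes G :: "(nat \<Rightarrow> nat \<Rightarrow> real) \<Rightarrow> real" and C :: "nat \<Rightarrow> nat set"
  assumes K: "finite K" and D: "finite D" and i: "i \<in> D"
    and C: "\<And>l. l \<in> K \<Longrightarrow> C l \<subseteq> D - {i}"
    and G: "\<And>s. G s \<in> {0, 1}"
    and flip: "\<And>s J. s \<in> K \<rightarrow>\<^sub>E sign_funs D \<Longrightarrow> J \<in> PiE K C \<Longrightarrow>
                 (\<And>l. l \<in> K \<Longrightarrow> s l i * s l (J l) = -1) \<Longrightarrow> 1 \<le> G s + G (flip_signs K J s)"
  shows "card (K \<rightarrow>\<^sub>E sign_funs D) * (\<Prod>l\<in>K. real (card (C l)) / (real (card (C l)) + 1)) \<le>
         4 * (\<Sum>s\<in>K \<rightarrow>\<^sub>E sign_funs D. G s)"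
proof (cases "\<exists>l\<in>K. C l = {}")
  \<comment> \<open>A row without a collision offers nothing to flip, but its factor
    \<open>0 / (0 + 1)\<close> makes the bound trivial.\<close>
  case True
  then have "(\<Prod>l\<in>K. real (card (C l)) / (real (card (C l)) + 1)) = 0"
    using K by (subst prod_zero_iff) (auto intro!: bexI)
  moreover have "0 \<le> (\<Sum>s\<in>K \<rightarrow>\<^sub>E sign_funs D. G s)"
    using G by (intro sum_nonneg) (metis insert_iff empty_iff order_refl zero_le_one)
  ultimately show ?thesis by simp
next
  case False
  define S where "S = K \<rightarrow>\<^sub>E sign_funs D"
  define N where "N = real (card S)"
  \<comment> \<open>For \<open>e\<close> equal to 1 or -1 and \<open>J\<close> in
    \<open>PiE K C\<close>, on \<open>S\<close> this is \<open>2 ^ card K\<close> times the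
    indicator that all relative signs at \<open>J\<close> equal \<open>e\<close>: the density after,
    respectively before, the flip. \<open>L e\<close> is its average over \<open>J\<close>.\<close>
  define Z where "Z e J s = (\<Prod>l\<in>K. 1 + e * (s l i * s l (J l)))"
    for e :: real and J :: "nat \<Rightarrow> nat" and s :: "nat \<Rightarrow> nat \<Rightarrow> real"
  define L where "L e s = (\<Prod>l\<in>K. 1 + e * (\<Sum>j\<in>C l. s l i * s l j) / card (C l))"
    for e :: real and s :: "nat \<Rightarrow> nat \<Rightarrow> real"
  define m where "m = (\<Prod>l\<in>K. real (card (C l)))"
  define R where "R = (\<Prod>l\<in>K. 1 + 1 / real (card (C l)))"
  have fC: "finite (C l)" if "l \<in> K" for l
    using C[OF that] D by (meson finite_Diff finite_subset)
  have C0: "card (C l) > 0" if "l \<in> K" for l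
    using fC that False by (auto simp: card_gt_0_iff)
  have m0: "m > 0" unfolding m_def using C0 by (intro prod_pos) auto
  have R1: "R > 0" unfolding R_def using C0 by (intro prod_pos) (auto intro: add_pos_nonneg)
  have fSD: "finite (sign_funs D)" using D by (auto intro: finite_PiE)
  have NSD: "N = real (card (sign_funs D)) ^ card K"
    using K by (simp add: N_def S_def card_PiE)
  have fixed_J: "N \<le> (\<Sum>s\<in>S. G s * Z (-1) J s) + (\<Sum>s\<in>S. G s * Z 1 J s)" if J: "J \<in> PiE K C" for J
  proof -
    have JD: "J l \<in> D" "i \<noteq> J l" if "l \<in> K" for l
      using C[OF that] PiE_mem[OF J that] by auto
    \<comment> \<open>The density has total mass \<open>N\<close>, since each relative sign has mean
      zero.\<close>
    have "(\<Sum>s\<in>S. Z (-1) J s) = (\<Prod>l\<in>K. \<Sum>x\<in>sign_funs D. 1 + -1 * (x i * x (J l)))"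
      unfolding S_def Z_def using K fSD
      by (rule sum_PiE_prod[where f = "\<lambda>l x. 1 + -1 * (x i * x (J l))"])
    also have "\<dots> = (\<Prod>l\<in>K. real (card (sign_funs D)))"
      using JD i by (intro prod.cong refl) (simp add: sum_subtractf sum_sign_funs_mult)
    also have "\<dots> = N" by (simp add: NSD)
    finally have "N = (\<Sum>s\<in>S. Z (-1) J s)" ..
    also have "\<dots> \<le> (\<Sum>s\<in>S. G s * Z (-1) J s + G (flip_signs K J s) * Z (-1) J s)"
    proof (intro sum_mono)
      fix s assume s: "s \<in> S"
      have sgn: "s l i * s l (J l) \<in> {-1, 1}" if "l \<in> K" for l
      proof -
        have "s l \<in> sign_funs D" using s that by (auto simp: S_def)
        from PiE_mem[OF this i] PiE_mem[OF this JD(1)[OF that]] show ?thesis by auto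
      qed
      show "Z (-1) J s \<le> G s * Z (-1) J s + G (flip_signs K J s) * Z (-1) J s"
      proof (cases "\<forall>l\<in>K. s l i * s l (J l) = -1")
        case True
        then have "1 \<le> G s + G (flip_signs K J s)"
          using flip[OF s[unfolded S_def] J] by blast
        moreover have "0 \<le> Z (-1) J s"
          unfolding Z_def using True by (intro prod_nonneg) auto
        ultimately have "1 * Z (-1) J s \<le> (G s + G (flip_signs K J s)) * Z (-1) J s"
          by (rule mult_right_mono)
        then show ?thesis by (simp add: algebra_simps)
      next
        case False
        then have "\<exists>l\<in>K. s l i * s l (J l) = 1" using sgn by blast
        then have "Z (-1) J s = 0"
          unfolding Z_def using K by (subst prod_zero_iff) auto
        then show ?thesis by simp
      qed
    qed
    also have "(\<Sum>s\<in>S. G s * Z (-1) J s + G (flip_signs K J s) * Z (-1) J s) =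
               (\<Sum>s\<in>S. G s * Z (-1) J s) + (\<Sum>s\<in>S. G (flip_signs K J s) * Z (-1) J s)"
      by (rule sum.distrib)
    \<comment> \<open>Substituting the flipped state as the summation variable replaces the density
      before the flip by the one after it.\<close>
    also have "(\<Sum>s\<in>S. G (flip_signs K J s) * Z (-1) J s) =
               (\<Sum>s\<in>S. G (flip_signs K J s) * Z 1 J (flip_signs K J s))"
    proof -
      have "Z 1 J (flip_signs K J s) = Z (-1) J s" for s
        unfolding Z_def using JD by (intro prod.cong refl) (simp add: flip_signs_def)
      then show ?thesis by simp
    qed
    also have "\<dots> = (\<Sum>s\<in>S. G s * Z 1 J s)"
      unfolding S_def
      by (rule sum.reindex_bij_betw[OF bij_betw_flip_signs[OF JD(1)], where g = "\<lambda>s. G s * Z 1 J s"])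
    finally show ?thesis .
  qed
  have sum_Z: "(\<Sum>J\<in>PiE K C. Z e J s) = m * L e s" for e s
  proof -
    have "(\<Sum>J\<in>PiE K C. Z e J s) = (\<Prod>l\<in>K. \<Sum>j\<in>C l. 1 + e * (s l i * s l j))"
      unfolding Z_def using K fC by (subst prod_sum_PiE) auto
    also have "\<dots> = (\<Prod>l\<in>K. real (card (C l)) * (1 + e * (\<Sum>j\<in>C l. s l i * s l j) / card (C l)))"
    proof (rule prod.cong[OF refl])
      fix l assume "l \<in> K"
      from C0[OF this] show "(\<Sum>j\<in>C l. 1 + e * (s l i * s l j)) =
          real (card (C l)) * (1 + e * (\<Sum>j\<in>C l. s l i * s l j) / card (C l))"
        by (simp add: sum.distrib distrib_left flip: sum_distrib_left)
    qed
    finally show ?thesis by (simp add: m_def L_def prod.distrib)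
  qed
  have "m * N = (\<Sum>J\<in>PiE K C. N)"
    using K by (simp add: m_def card_PiE)
  also have "\<dots> \<le> (\<Sum>J\<in>PiE K C. (\<Sum>s\<in>S. G s * Z (-1) J s) + (\<Sum>s\<in>S. G s * Z 1 J s))"
    by (intro sum_mono fixed_J)
  also have "\<dots> = (\<Sum>s\<in>S. G s * (m * L (-1) s)) + (\<Sum>s\<in>S. G s * (m * L 1 s))"
    unfolding sum.distrib sum_Z[symmetric] sum_distrib_left by (intro arg_cong2[of _ _ _ _ "(+)"] sum.swap)
  also have "\<dots> = m * ((\<Sum>s\<in>S. G s * L (-1) s) + (\<Sum>s\<in>S. G s * L 1 s))"
    by (simp add: sum_distrib_left distrib_left mult_ac)
  finally have main: "N \<le> (\<Sum>s\<in>S. G s * L (-1) s) + (\<Sum>s\<in>S. G s * L 1 s)"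
    using m0 by simp
  have second_moment: "(\<Sum>s\<in>S. (L e s)\<^sup>2) = N * R" if e: "e * e = 1" for e
  proof -
    have "(\<Sum>s\<in>S. (L e s)\<^sup>2) =
      (\<Prod>l\<in>K. \<Sum>x\<in>sign_funs D. (1 + e * (\<Sum>j\<in>C l. x i * x j) / card (C l))\<^sup>2)"
      unfolding S_def L_def prod_power_distrib using K fSD
      by (rule sum_PiE_prod[where f = "\<lambda>l x. (1 + e * (\<Sum>j\<in>C l. x i * x j) / card (C l))\<^sup>2"])
    also have "\<dots> = (\<Prod>l\<in>K. card (sign_funs D) * (1 + 1 / card (C l)))"
      using C False D i e by (intro prod.cong refl sum_sign_funs_mean_square) auto
    finally show ?thesis by (simp add: prod.distrib NSD R_def)
  qed
  have bound: "(\<Sum>s\<in>S. G s * L e s) \<le> R * (\<Sum>s\<in>S. G s) + N / 4" if e: "e * e = 1" for e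
  proof -
    \<comment> \<open>Completing the square with weight \<open>R\<close> makes the second moment
      cost exactly \<open>N / 4\<close>. The two values of \<open>e\<close> together cost
      \<open>N / 2\<close>, which leaves half of \<open>N\<close> for \<open>G\<close>.\<close>
    have "G s * L e s \<le> R * G s + (L e s)\<^sup>2 / (4 * R)" for s
    proof -
      have "0 \<le> (2 * R - L e s)\<^sup>2 / (4 * R)" using R1 by simp
      also have "\<dots> = R - L e s + (L e s)\<^sup>2 / (4 * R)"
        using R1 by (simp add: field_simps power2_eq_square)
      finally show ?thesis using G[of s] R1 by auto
    qed
    then have "(\<Sum>s\<in>S. G s * L e s) \<le> (\<Sum>s\<in>S. R * G s + (L e s)\<^sup>2 / (4 * R))"
      by (rule sum_mono)
    also have "\<dots> = R * (\<Sum>s\<in>S. G s) + N / 4"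
      using R1 second_moment[OF e]
      by (simp add: sum.distrib sum_distrib_left[symmetric] sum_divide_distrib[symmetric])
    finally show ?thesis .
  qed
  have "N \<le> 4 * R * (\<Sum>s\<in>S. G s)"
    using main bound[of "-1"] bound[of 1] by simp
  moreover have "(\<Prod>l\<in>K. real (card (C l)) / (real (card (C l)) + 1)) = 1 / R"
  proof -
    have "(\<Prod>l\<in>K. real (card (C l)) / (real (card (C l)) + 1)) = (\<Prod>l\<in>K. 1 / (1 + 1 / real (card (C l))))"
      using C0 by (intro prod.cong refl) (fastforce simp: field_simps)
    then show ?thesis by (simp add: R_def prod_dividef)
  qed
  ultimately show ?thesis
    using R1 by (simp only: N_def S_def) (simp add: field_simps)
qed

section \<open>A numerical bound for the product over rows\<close>

text \<open>Bernoulli with exponent \<open>k\<close> would only give 0. With exponent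
  \<open>(k + 1) / 2\<close> it gives at least \<open>1 / 3\<close>, and squaring reaches the
  exponent \<open>k + 1\<close>.\<close>

lemma one_minus_inverse_power_ge:
  fixes k :: nat
  assumes "k \<ge> 3" "odd k"
  shows "(1 - 1 / real k) ^ k \<ge> 1 / 9"
proof -
  obtain m where m: "k = 2 * m + 1" "m \<ge> 1" using assms by (auto elim!: oddE)
  have "1 / 3 \<le> 1 + real (m + 1) * (- (1 / real k))"
    using m by (simp add: field_simps)
  also have "\<dots> \<le> (1 + - (1 / real k)) ^ (m + 1)"
    using m by (intro Bernoulli_inequality) (simp add: field_simps)
  finally have "(1 / 3)\<^sup>2 \<le> ((1 - 1 / real k) ^ (m + 1))\<^sup>2"
    by (intro power_mono) auto
  also have "\<dots> = (1 - 1 / real k) ^ (2 * m + 2)"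
    unfolding power_mult[symmetric] by (rule arg_cong[where f = "power _"]) simp
  also have "\<dots> \<le> (1 - 1 / real k) ^ k"
    using m by (intro power_decreasing) auto
  finally show ?thesis by (simp add: power2_eq_square)
qed

section \<open>The lower bound for the expected error\<close>

theorem theorem16:
  "\<exists>c::real. c > 0 \<and>
     (\<forall>n B1 B2 k i :: nat.
        n > 0 \<and> B1 > 0 \<and> B2 > 0 \<and> n \<ge> B1 + B2 \<and> B1 + B2 \<ge> 2 * B1 \<and>
        k \<ge> 3 \<and> odd k \<and> k dvd B2 \<and> i \<in> {1..n} - {1..B1} \<longrightarrow>
        measure_pmf.expectation (sketch_pmf n B1 B2 k)
          (\<lambda>(h, s). \<bar>estimate n B1 k h s i - freq i\<bar>) \<ge> c / real B2)"
proof (intro exI[of _ "1 / 72"] conjI allI impI, simp, elim conjE)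
  \<comment> \<open>The constant is the product of \<open>1 / 9\<close> from the rows of
    \<open>h\<close>, \<open>1 / 4\<close> from the anticoncentration over the signs, and
    \<open>1 / 2\<close> from the error threshold.\<close>
  fix n B1 B2 k i :: nat
  assume pos: "B2 > 0" and n: "n \<ge> B1 + B2" and B12: "B1 + B2 \<ge> 2 * B1"
    and k: "k \<ge> 3" "odd k" "k dvd B2" and i: "i \<in> {1..n} - {1..B1}"
  define b where "b = B2 div k"
  define D where "D = {1..n} - {1..B1}"
  define W where "W = {B1+1..B1+B2} - {i}"
  define H where "H = {1..k} \<rightarrow>\<^sub>E (D \<rightarrow>\<^sub>E {1..b})"
  define S where "S = {1..k} \<rightarrow>\<^sub>E sign_funs D"
  define C where "C g = {j\<in>W. g j = g i}" for g :: "nat \<Rightarrow> nat"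
  define err where "err h s = \<bar>estimate n B1 k h s i - freq i\<bar>" for h s
  define G where "G h s = (of_bool (err h s \<ge> 1 / (2 * real B2)) :: real)" for h s
  have B2: "B2 = b * k" and b: "b > 0" using k pos by (auto simp: b_def)
  have fD: "finite D" and iD: "i \<in> D" and WD: "W \<subseteq> D - {i}" and fW: "finite W"
    using i n by (auto simp: D_def W_def)
  have H: "finite H" "H \<noteq> {}" and S: "finite S" "S \<noteq> {}"
    using b fD by (auto simp: H_def S_def finite_PiE PiE_eq_empty_iff)
  have flip: "1 \<le> G h s + G h (flip_signs {1..k} J s)"
    if s: "s \<in> {1..k} \<rightarrow>\<^sub>E sign_funs D" and J: "J \<in> PiE {1..k} (\<lambda>l. C (h l))"
      and disagree: "\<And>l. l \<in> {1..k} \<Longrightarrow> s l i * s l (J l) = -1" for h s J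
  proof -
    define s' where "s' = flip_signs {1..k} J s"
    let ?X = "\<lambda>s l. s l i * (\<Sum>j\<in>D. of_bool (h l j = h l i) * s l j * freq j)"
    have "?X s l + 1 / real B2 \<le> ?X s' l" if l: "l \<in> {1..k}" for l
    proof -
      have Jl: "J l \<in> W" "h l (J l) = h l i" using PiE_mem[OF J l] by (auto simp: C_def)
      then have JD: "J l \<in> D" "J l \<noteq> i" using WD by auto
      have s'_eq: "s' l j = (if j = J l then - s l j else s l j)" for j
        using l by (simp add: s'_def flip_signs_def)
      have "(\<Sum>j\<in>D. of_bool (h l j = h l i) * s' l j * freq j) =
            (\<Sum>j\<in>D. of_bool (h l j = h l i) * s l j * freq j) +
            (\<Sum>j\<in>D. if j = J l then - 2 * s l (J l) * freq (J l) else 0)"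
        unfolding sum.distrib[symmetric] using Jl by (intro sum.cong refl) (auto simp: s'_eq)
      also have "(\<Sum>j\<in>D. if j = J l then - 2 * s l (J l) * freq (J l) else 0) =
                 - 2 * s l (J l) * freq (J l)"
        using JD fD by simp
      finally have "?X s' l = ?X s l - 2 * (s l i * s l (J l)) * freq (J l)"
        using JD(2) by (simp add: s'_eq right_diff_distrib)
      then have "?X s' l - ?X s l = 2 * freq (J l)" using disagree[OF l] by simp
      moreover have "1 / real B2 \<le> 2 * freq (J l)"
      \<comment> \<open>Here \<open>B1 + B2 \<ge> 2 * B1\<close> enters: it gives
        \<open>B1 \<le> B2\<close>, so every index in \<open>W\<close> is at most
        \<open>2 * B2\<close>.\<close>
      proof -
        have "J l \<le> 2 * B2" "J l > 0" using Jl B12 by (auto simp: W_def)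
        then have "real (J l) \<le> 2 * real B2" by linarith
        then show ?thesis using \<open>J l > 0\<close> pos by (simp add: freq_def field_simps)
      qed
      ultimately show ?thesis by simp
    qed
    then have "median (map (?X s) [1..<k+1]) + 1 / real B2 \<le> median (map (?X s') [1..<k+1])"
      using k by (intro median_map_add_mono) auto
    \<comment> \<open>Both medians are compared with the same \<open>freq i\<close>, so by the
      triangle inequality one of the two errors is at least half the gap.\<close>
    then have "1 / real B2 \<le> err h s + err h s'"
      unfolding err_def estimate_def D_def by linarith
    then show ?thesis using pos unfolding s'_def[symmetric] by (auto simp: G_def field_simps)
  qed
  define \<phi> where "\<phi> g = real (card (C g)) / (real (card (C g)) + 1)" for g
  have rows: "card S * (\<Prod>l\<in>{1..k}. \<phi> (h l)) \<le> 4 * (\<Sum>s\<in>S. G h s)" for h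
    unfolding \<phi>_def S_def
    by (rule flip_anticoncentration[OF _ fD iD])
       (use WD flip in \<open>auto simp: C_def G_def\<close>)
  have buckets: "(1 - 1 / real k) * card (D \<rightarrow>\<^sub>E {1..b}) \<le> (\<Sum>g\<in>D \<rightarrow>\<^sub>E {1..b}. \<phi> g)"
  proof -
    \<comment> \<open>Putting \<open>i\<close> back makes the bucket size
      \<open>card (C g) + 1\<close>, and the set has at least \<open>B2\<close> elements whether or
      not \<open>i\<close> is among the \<open>B2\<close> largest.\<close>
    let ?V = "insert i W"
    have cV: "card ?V \<ge> B2"
      using card_mono[of ?V "{B1+1..B1+B2}"] by (auto simp: W_def)
    have "{j\<in>?V. g j = g i} = insert i (C g)" "i \<notin> C g" "finite (C g)" for g
      using fW by (auto simp: C_def W_def)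
    then have \<phi>: "\<phi> g = 1 - 1 / real (card {j\<in>?V. g j = g i})" for g
      by (simp add: \<phi>_def field_simps)
    let ?T = "\<Sum>g\<in>D \<rightarrow>\<^sub>E {1..b}. 1 / real (card {j\<in>?V. g j = g i})"
    have "real B2 * ?T \<le> card ?V * ?T"
      using cV by (intro mult_right_mono sum_nonneg) auto
    also have "\<dots> \<le> real b * real (card (D \<rightarrow>\<^sub>E {1..b}))"
      using sum_inverse_bucket_size[of D ?V i "{1..b}"] fD iD WD by auto
    finally have "?T \<le> card (D \<rightarrow>\<^sub>E {1..b}) / real k"
      using b k unfolding B2 by (simp add: field_simps)
    then show ?thesis by (simp add: \<phi> sum_subtractf left_diff_distrib)
  qed
  have "1 / 9 * real (card H) \<le> (1 - 1 / real k) ^ k * card H"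
    using one_minus_inverse_power_ge[OF k(1,2)] by (intro mult_right_mono) auto
  also have "\<dots> = ((1 - 1 / real k) * card (D \<rightarrow>\<^sub>E {1..b})) ^ k"
    by (simp add: H_def card_PiE power_mult_distrib)
  also have "\<dots> \<le> (\<Sum>g\<in>D \<rightarrow>\<^sub>E {1..b}. \<phi> g) ^ k"
    using k by (intro power_mono buckets) auto
  also have "\<dots> = (\<Sum>h\<in>H. \<Prod>l\<in>{1..k}. \<phi> (h l))"
    unfolding H_def using fD by (subst sum_PiE_prod) (auto intro: finite_PiE)
  finally have "card S * (1 / 9 * real (card H)) \<le> card S * (\<Sum>h\<in>H. \<Prod>l\<in>{1..k}. \<phi> (h l))"
    by (intro mult_left_mono) auto
  also have "\<dots> \<le> (\<Sum>h\<in>H. 4 * (\<Sum>s\<in>S. G h s))"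
    unfolding sum_distrib_left by (intro sum_mono rows[unfolded sum_distrib_left])
  \<comment> \<open>Markov's inequality in pointwise form, at the threshold
    \<open>1 / (2 * B2)\<close>.\<close>
  also have "\<dots> \<le> (\<Sum>h\<in>H. 4 * (\<Sum>s\<in>S. 2 * real B2 * err h s))"
  proof (intro sum_mono mult_left_mono)
    show "G h s \<le> 2 * real B2 * err h s" for h s
      using pos by (auto simp: G_def field_simps err_def)
  qed auto
  also have "\<dots> = 8 * real B2 * (\<Sum>h\<in>H. \<Sum>s\<in>S. err h s)"
    by (simp flip: sum_distrib_left)
  finally have "1 / 72 / real B2 \<le> (\<Sum>h\<in>H. \<Sum>s\<in>S. err h s) / (real (card H) * real (card S))"
    using H S pos by (simp add: field_simps card_gt_0_iff)
  also have "\<dots> = measure_pmf.expectation (sketch_pmf n B1 B2 k)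
          (\<lambda>(h, s). \<bar>estimate n B1 k h s i - freq i\<bar>)"
    using b by (simp add: expectation_sketch_pmf b_def H_def S_def D_def err_def)
  finally show "1 / 72 / real B2 \<le> measure_pmf.expectation (sketch_pmf n B1 B2 k)
          (\<lambda>(h, s). \<bar>estimate n B1 k h s i - freq i\<bar>)" .
qed

end
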